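(* Let $A$ be any online $k$-server algorithm on a metric space of diameter $\mathrm{diam}$, let $\sigma$ be any (fixed) request sequence, and let $\mathrm{cost}(A,\sigma)$ be the total cost of $A$ on $\sigma$. Run the phased random swapping algorithm described in the context with input $A$ and parameter $\gamma>0$. Then for any $\varepsilon>0$, with probability at least $1-k\cdot\exp\!\left(-\Omega\!\left(\frac{\varepsilon^2}{\gamma\cdot k}\cdot\mathrm{cost}(A,\sigma)^{1/(\gamma+1)}\right)\right)$, each server incurs cost at most $(1+\varepsilon)\frac{\mathrm{cost}(A,\sigma)}{k}+O\!\left(\mathrm{cost}(A,\sigma)^{1/(\gamma+1)}\cdot\mathrm{diam}\right)$. Further, the total cost across all servers is at most $\mathrm{cost}(A,\sigma)+O\!\left(\mathrm{cost}(A,\sigma)^{1/(\gamma+1)}\cdot k\cdot\mathrm{diam}\right)$.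
   Context: The $k$-server problem: $k$ servers labeled $1,\dots,k$ start at given positions in a metric space $(M,d)$; requests $\sigma_1,\sigma_2,\dots\in M$ arrive online and after request $\sigma_t$ some server must be at $\sigma_t$; moving a server from $x$ to $y$ costs $d(x,y)$; the cost of a server is the total distance it moves. Phased random swapping algorithm with base algorithm $A$ and parameter $\gamma>0$: the input is divided into phases $\ell=1,2,\dots$; phase $\ell$ has budget $\phi_\ell=\ell^\gamma$. At the start of each phase (including the first), a permutation $\pi_\ell$ of $[k]$ is chosen uniformly at random, independently of everything else, and the servers are repositioned according to it: server $i$ moves to the current position of server $\pi_\ell(i)$ and from then on plays the role of that server of $A$ (i.e. the set of occupied positions is unchanged but identities are permuted; each repositioning move costs the distance moved, at most $\mathrm{diam}$). Each request is served by simulating $A$ (under the current relabeling), and the cost $A$ incurs is added to a phase counter $U_\ell$; as soon as $U_\ell\ge\phi_\ell$, the phase ends, $\ell$ is incremented, $U_\ell$ is reset to $0$ and a new random repositioning is performed. Server costs include repositioning costs.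
   Formalization: The hidden constants are not absolute: cost(A,σ) is bounded below by any fixed positive threshold, on which O may depend; the Ω-constant may also depend on a lower bound for γ and an upper bound for ε. With absolute constants the claim fails (cost 0, γ→0, ε→∞). A is deterministic. *)

theory Defs
  imports "HOL-Probability.Probability" "HOL-Combinatorics.Permutations"
begin

definition space_diam :: "'a set \<Rightarrow> ('a \<Rightarrow> 'a \<Rightarrow> real) \<Rightarrow> real" where
  "space_diam M d = Sup {d x y | x y. x \<in> M \<and> y \<in> M}"

(* A deterministic online algorithm for servers labelled 1..k: "A h j" is the position of server j
   after the request history h has been served (oldest request first).  "A []" gives the initial
   positions.  Being a function of the history makes the algorithm online.  Several servers may
   move at one request. *)
type_synonym 'a online_alg = "'a list \<Rightarrow> nat \<Rightarrow> 'a"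

definition kserver_alg :: "'a set \<Rightarrow> nat \<Rightarrow> 'a online_alg \<Rightarrow> bool" where
  "kserver_alg M k A \<longleftrightarrow>
     (\<forall>h \<in> lists M. \<forall>j \<in> {1..k}. A h j \<in> M) \<and>
     (\<forall>h \<in> lists M. \<forall>r \<in> M. \<exists>j \<in> {1..k}. A (h @ [r]) j = r)"

definition step_cost :: "('a \<Rightarrow> 'a \<Rightarrow> real) \<Rightarrow> nat \<Rightarrow> 'a online_alg \<Rightarrow> 'a list \<Rightarrow> 'a \<Rightarrow> real" where
  "step_cost d k A h r = (\<Sum>j = 1..k. d (A h j) (A (h @ [r]) j))"

definition alg_cost :: "('a \<Rightarrow> 'a \<Rightarrow> real) \<Rightarrow> nat \<Rightarrow> 'a online_alg \<Rightarrow> 'a list \<Rightarrow> real" where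
  "alg_cost d k A \<sigma> = (\<Sum>t < length \<sigma>. step_cost d k A (take t \<sigma>) (\<sigma> ! t))"

(* "role s i" is the label of the server of A that the real server i currently plays. *)
record 'a swap_state =
  hist     :: "'a list"
  phase    :: nat
  counter  :: real
  role     :: "nat \<Rightarrow> nat"
  pos      :: "nat \<Rightarrow> 'a"
  srv_cost :: "nat \<Rightarrow> real"

definition swap_init :: "'a online_alg \<Rightarrow> 'a swap_state" where
  "swap_init A = \<lparr> hist = [], phase = 1, counter = 0, role = id, pos = A [],
                   srv_cost = (\<lambda>i. 0) \<rparr>"

definition phase_budget :: "real \<Rightarrow> nat \<Rightarrow> real" where
  "phase_budget \<gamma> l = real l powr \<gamma>"

(* The cost of repositioning is charged to the moving servers, but not to the phase counter. *)
definition reposition ::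
    "('a \<Rightarrow> 'a \<Rightarrow> real) \<Rightarrow> nat \<Rightarrow> 'a swap_state \<Rightarrow> 'a swap_state pmf" where
  "reposition d k s =
     map_pmf (\<lambda>p. s \<lparr> role := (\<lambda>i. role s (p i)),
                       pos := (\<lambda>i. pos s (p i)),
                       srv_cost := (\<lambda>i. srv_cost s i + d (pos s i) (pos s (p i))) \<rparr>)
       (pmf_of_set {p. p permutes {1..k}})"

definition serve ::
    "('a \<Rightarrow> 'a \<Rightarrow> real) \<Rightarrow> nat \<Rightarrow> 'a online_alg \<Rightarrow> 'a \<Rightarrow> 'a swap_state \<Rightarrow> 'a swap_state" where
  "serve d k A r s =
     (let pos' = (\<lambda>i. A (hist s @ [r]) (role s i)) in
      s \<lparr> hist := hist s @ [r],
          counter := counter s + step_cost d k A (hist s) r,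
          pos := pos',
          srv_cost := (\<lambda>i. srv_cost s i + d (pos s i) (pos' i)) \<rparr>)"

definition swap_step ::
    "('a \<Rightarrow> 'a \<Rightarrow> real) \<Rightarrow> nat \<Rightarrow> 'a online_alg \<Rightarrow> real \<Rightarrow> 'a \<Rightarrow> 'a swap_state \<Rightarrow> 'a swap_state pmf" where
  "swap_step d k A \<gamma> r s =
     (let s' = serve d k A r s in
      if counter s' \<ge> phase_budget \<gamma> (phase s')
      then reposition d k (s' \<lparr> phase := phase s' + 1, counter := 0 \<rparr>)
      else return_pmf s')"

primrec swap_run ::
    "('a \<Rightarrow> 'a \<Rightarrow> real) \<Rightarrow> nat \<Rightarrow> 'a online_alg \<Rightarrow> real \<Rightarrow> 'a list \<Rightarrow> 'a swap_state \<Rightarrow> 'a swap_state pmf" where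
  "swap_run d k A \<gamma> [] s = return_pmf s"
| "swap_run d k A \<gamma> (r # rs) s = bind_pmf (swap_step d k A \<gamma> r s) (swap_run d k A \<gamma> rs)"

(* Distribution of the final state; the first phase also starts with a random repositioning. *)
definition phased_swapping ::
    "('a \<Rightarrow> 'a \<Rightarrow> real) \<Rightarrow> nat \<Rightarrow> 'a online_alg \<Rightarrow> real \<Rightarrow> 'a list \<Rightarrow> 'a swap_state pmf" where
  "phased_swapping d k A \<gamma> \<sigma> = bind_pmf (reposition d k (swap_init A)) (swap_run d k A \<gamma> \<sigma>)"

end

theory Submission
  imports Defs
begin

text \<open>
  The phases do not depend on the random permutations, and \<open>L\<close> completed phases force the base
  algorithm to pay at least \<open>\<Sum>l\<le>L. l powr \<gamma> \<ge> L powr (\<gamma> + 1) / (\<gamma> + 1)\<close>; as \<open>p powr (1 / p)\<close> is bounded,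
  the number of phases is \<open>O(W powr (1 / (\<gamma> + 1)))\<close>, where \<open>W\<close> is the cost of the base algorithm. Every
  phase costs a server at most \<open>2 * diam\<close> for the repositioning and for the request that exceeds the
  budget. The remaining cost of a server in a phase is that of a uniformly random server of the base
  algorithm, at most the budget and independent of the other phases. A multiplicative Chernoff bound
  on the exponential moments gives the tail estimate; its exponent is proportional to the ratio of
  \<open>\<epsilon>\<^sup>2 * W / k\<close> to the last budget, which is \<open>O((\<gamma> + 1) * W powr (\<gamma> / (\<gamma> + 1)))\<close> when
  \<open>\<gamma> \<le> W powr (1 / (\<gamma> + 1))\<close>. In the other case, for suitably small constants, the
  claimed probability is not positive when \<open>k \<ge> 2\<close>, while for \<open>k = 1\<close> the bound on the total cost
  suffices.
\<close>

section \<open>Inequalities for exponentials and powers\<close>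

text \<open>By convexity, \<open>exp\<close> lies below its chord over the segment between
  \<open>0\<close> and \<open>lam * B\<close>.\<close>

lemma exp_le_chord:
  fixes x B lam :: real
  assumes "0 \<le> x" "x \<le> B" "0 < B"
  shows "exp (lam * x) \<le> 1 + (exp (lam * B) - 1) * x / B"
proof -
  have "exp ((1 - x / B) *\<^sub>R 0 + (x / B) *\<^sub>R (lam * B))
        \<le> (1 - x / B) * exp 0 + (x / B) * exp (lam * B)"
    using assms by (intro convex_onD[OF exp_convex]) auto
  moreover have "(1 - x / B) *\<^sub>R 0 + (x / B) *\<^sub>R (lam * B) = lam * x"
    using assms by simp
  ultimately show ?thesis
    by (simp add: algebra_simps diff_divide_distrib)
qed

text \<open>This is the exponential moment of the load of a uniformly chosen server. Averaging the
  chord bounds gives some \<open>1 + y\<close>, and \<open>1 + y \<le> exp y\<close>. As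
  \<open>y\<close> is linear in the total load, the bounds of successive phases multiply to one
  governed by the total cost.\<close>

lemma mean_exp_le:
  fixes x :: "nat \<Rightarrow> real"
  assumes "1 \<le> k" "0 < B" "0 \<le> lam" and x: "\<And>j. j \<in> {1..k} \<Longrightarrow> 0 \<le> x j"
    and le: "(\<Sum>j = 1..k. x j) \<le> B"
  shows "(\<Sum>j = 1..k. exp (lam * x j)) / real k
         \<le> exp ((exp (lam * B) - 1) * (\<Sum>j = 1..k. x j) / (real k * B))"
proof -
  have xB: "x j \<le> B" if "j \<in> {1..k}" for j
    using member_le_sum[of j "{1..k}" x] that x le by force
  have "(\<Sum>j = 1..k. exp (lam * x j)) \<le> (\<Sum>j = 1..k. 1 + (exp (lam * B) - 1) * x j / B)"
    by (intro sum_mono exp_le_chord x xB assms)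
  also have "\<dots> = real k + (exp (lam * B) - 1) * (\<Sum>j = 1..k. x j) / B"
    by (simp add: sum.distrib sum_distrib_left sum_divide_distrib)
  finally have "(\<Sum>j = 1..k. exp (lam * x j)) / real k
      \<le> 1 + (exp (lam * B) - 1) * (\<Sum>j = 1..k. x j) / (real k * B)"
    using assms by (simp add: field_simps)
  also have "\<dots> \<le> exp ((exp (lam * B) - 1) * (\<Sum>j = 1..k. x j) / (real k * B))"
    by (rule exp_ge_add_one_self)
  finally show ?thesis .
qed

text \<open>Mean value theorem with the increasing derivative \<open>(g + 1) * z powr g\<close>; the
  case \<open>n = 0\<close> is split off to keep the interval away from \<open>0\<close>. It serves
  to telescope the budgets into a power.\<close>

lemma powr_Suc_diff_le:
  fixes g :: real
  assumes "0 < g"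
  shows "real (Suc n) powr (g + 1) - real n powr (g + 1) \<le> (g + 1) * real (Suc n) powr g"
proof (cases "n = 0")
  case False
  have "\<exists>z. real n < z \<and> z < real (Suc n) \<and>
      real (Suc n) powr (g + 1) - real n powr (g + 1) = (real (Suc n) - real n) * ((g + 1) * z powr g)"
    by (rule MVT2) (use False assms in \<open>auto intro!: derivative_eq_intros\<close>)
  then obtain z where z: "real n < z" "z < real (Suc n)"
    "real (Suc n) powr (g + 1) - real n powr (g + 1) = (g + 1) * z powr g" by auto
  then have "z powr g \<le> real (Suc n) powr g"
    using assms by (intro powr_mono2) auto
  then show ?thesis using z(3) assms by (simp add: mult_left_mono)
qed (use assms in simp)

text \<open>With \<open>t = e / (2 + e0)\<close>, the bound \<open>e \<le> e0\<close> gives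
  \<open>t \<le> 1\<close>, so \<open>exp t - 1 - t\<close> is at most the square of
  \<open>t\<close>. The subtracted term exceeds \<open>t\<close> by \<open>2 + e0 \<ge> 2\<close>
  times that square, so half of this excess survives.\<close>

lemma exp_exponent_le:
  fixes e e0 :: real
  assumes "0 < e" "e \<le> e0"
  shows "exp (e / (2 + e0)) - 1 - e / (2 + e0) * (1 + e) \<le> - (e\<^sup>2 / (2 * (2 + e0)))"
proof -
  define t where "t = e / (2 + e0)"
  have t: "0 \<le> t" "t \<le> 1" "e = t * (2 + e0)" "0 < e0"
    using assms by (auto simp: t_def field_simps)
  have "exp t \<le> 1 + t + t\<^sup>2" using t by (intro exp_bound) auto
  moreover have "t\<^sup>2 * 2 \<le> t\<^sup>2 * (2 + e0)" using t by (intro mult_left_mono) auto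
  moreover have "e\<^sup>2 / (2 * (2 + e0)) = t\<^sup>2 * (2 + e0) / 2"
    using t by (simp add: power2_eq_square field_simps)
  moreover have "t * (1 + e) = t + t\<^sup>2 * (2 + e0)"
    using t by (simp add: power2_eq_square algebra_simps)
  ultimately show ?thesis unfolding t_def[symmetric] by linarith
qed

text \<open>Since \<open>ln p \<le> p\<close>, the power is at most \<open>exp 1\<close>. This makes
  the constant in the phase count independent of \<open>g\<close>.\<close>

lemma powr_inverse_self_le: 
  fixes p :: real
  assumes "1 \<le> p"
  shows "p powr (1 / p) \<le> 3"
proof -
  have "ln p \<le> p" using ln_le_minus_one[of p] assms by simp
  then have "p powr (1 / p) \<le> exp 1"
    using assms by (simp add: powr_def field_simps)
  then show ?thesis using exp_le by linarith
qed

section \<open>Number of phases and size of the last budget\<close>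

text \<open>
  In the next three lemmas \<open>n\<close> is the number of completed phases, \<open>W\<close> the cost of the base
  algorithm, and \<open>w\<close> the quantity governing the error terms of the theorem.
\<close>

lemma phase_count_le:
  fixes g W :: real
  assumes "0 < g" "0 < W" and n: "real n powr (g + 1) / (g + 1) \<le> W"
  defines "w \<equiv> W powr (1 / (g + 1))"
  shows "real n \<le> (g + 1) powr (1 / (g + 1)) * w"
proof -
  have "real n = (real n powr (g + 1)) powr (1 / (g + 1))"
    using assms by (simp add: powr_powr)
  also have "\<dots> \<le> ((g + 1) * W) powr (1 / (g + 1))"
    using assms by (intro powr_mono2) (auto simp: field_simps)
  finally show ?thesis
    using assms by (simp add: powr_mult)
qed

lemma phase_number_le:
  fixes g W c0 :: real
  assumes "0 < g" "0 < c0" "c0 \<le> W" and n: "real n powr (g + 1) / (g + 1) \<le> W"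
  shows "real (Suc n) \<le> (3 + 1 / min 1 c0) * W powr (1 / (g + 1))"
proof -
  define w where "w = W powr (1 / (g + 1))"
  \<comment> \<open>A lower bound on \<open>w\<close> turns the additive \<open>1\<close> of
    \<open>Suc n\<close> into a multiple of \<open>w\<close>. For \<open>W < 1\<close> the exponent
    below \<open>1\<close> gives \<open>w \<ge> W \<ge> c0\<close>.\<close>
  have "min 1 c0 \<le> w"
  proof (cases "1 \<le> W")
    case True
    then have "1 \<le> w" using assms unfolding w_def by (intro ge_one_powr_ge_zero) auto
    then show ?thesis by simp
  next
    case False
    then have "W powr 1 \<le> w"
      unfolding w_def using assms by (intro powr_mono') auto
    then show ?thesis using assms by simp
  qed
  then have "1 \<le> 1 / min 1 c0 * w" using assms by (simp add: field_simps)
  moreover have "real n \<le> 3 * w"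
  proof -
    have "real n \<le> (g + 1) powr (1 / (g + 1)) * w"
      unfolding w_def using assms by (intro phase_count_le) auto
    also have "\<dots> \<le> 3 * w"
      using assms by (intro mult_right_mono powr_inverse_self_le) (auto simp: w_def)
    finally show ?thesis .
  qed
  ultimately show ?thesis unfolding w_def[symmetric] of_nat_Suc distrib_right by linarith
qed

lemma phase_budget_le:
  fixes g W :: real
  assumes "0 < g" "0 < W" and n: "real n powr (g + 1) / (g + 1) \<le> W"
  defines "w \<equiv> W powr (1 / (g + 1))"
  assumes gw: "g \<le> w"
  shows "phase_budget g (Suc n) * w \<le> 3 * (g + 1) * W"
proof -
  define q where "q = (g + 1) powr (1 / (g + 1))"
  have w0: "0 < w" using assms by simp
  have q1: "1 \<le> q" unfolding q_def using assms by (intro ge_one_powr_ge_zero) auto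
  have "real n \<le> q * w"
    unfolding q_def w_def using assms by (intro phase_count_le) auto
  then have "real (Suc n) \<le> q * w + q" using q1 by simp
  \<comment> \<open>The step from \<open>n\<close> to \<open>Suc n\<close> becomes a factor
    \<open>1 + 1 / w\<close>. Raised to the power \<open>g\<close> it is at most
    \<open>exp (g / w)\<close>, hence at most \<open>exp 1\<close> because
    \<open>g \<le> w\<close>.\<close>
  also have "\<dots> = q * w * (1 + 1 / w)" using w0 by (simp add: field_simps)
  also have "\<dots> \<le> q * w * exp (1 / w)"
    using w0 q1 by (intro mult_left_mono exp_ge_add_one_self) auto
  finally have "real (Suc n) powr g \<le> (q * w * exp (1 / w)) powr g"
    using assms by (intro powr_mono2) auto
  also have "\<dots> = q powr g * w powr g * exp (g / w)"
    using w0 q1 by (simp add: powr_mult exp_powr_real)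
  also have "\<dots> \<le> (g + 1) * w powr g * 3"
  proof (intro mult_mono)
    have "q powr g = (g + 1) powr (g / (g + 1))" by (simp add: q_def powr_powr)
    also have "\<dots> \<le> (g + 1) powr 1" using assms by (intro powr_mono) auto
    finally show "q powr g \<le> g + 1" using assms by simp
    have "exp (g / w) \<le> exp 1" using gw w0 by simp
    then show "exp (g / w) \<le> 3" using exp_le by linarith
  qed (use assms in auto)
  finally have "real (Suc n) powr g * w \<le> (g + 1) * w powr g * 3 * w"
    using w0 by (intro mult_right_mono) auto
  moreover have "w powr g * w = W"
  proof -
    have "w powr g * w = w powr (g + 1)" using w0 by (simp add: powr_add)
    also have "\<dots> = W" using assms by (simp add: w_def powr_powr)
    finally show ?thesis .
  qed
  then have "(g + 1) * w powr g * 3 * w = 3 * (g + 1) * W"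
    by (simp add: mult.assoc mult.left_commute)
  ultimately show ?thesis by (simp add: phase_budget_def)
qed

section \<open>Uniform random permutations\<close>

text \<open>Composing with a transposition shows that all images of \<open>i\<close> are equally likely.\<close>

lemma random_permutation_image:
  assumes S: "finite S" and i: "i \<in> S" and q: "q permutes S" and j: "j \<in> S"
  shows "emeasure (measure_pmf (pmf_of_set {p. p permutes S})) {p. q (p i) = j} = ennreal (1 / real (card S))"
proof -
  define P where "P = {p. p permutes S}"
  define F where "F x = {p. p permutes S \<and> p i = x}" for x
  have P: "finite P" "P \<noteq> {}"
    using S permutes_id[of S] unfolding P_def by (blast intro: finite_permutations)+
  \<comment> \<open>The event says that \<open>i\<close> is sent to \<open>inv q j\<close>, so it is
    one of the fibres \<open>F x\<close>, which partition the permutations.\<close>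
  have iq: "q x = j \<longleftrightarrow> x = inv q j" for x
    using permutes_inv_eq[OF q] by metis
  have b: "inv q j \<in> S"
    using permutes_inv[OF q] j by (simp add: permutes_in_image)
  have card_F: "card (F a) = card (F (inv q j))" if a: "a \<in> S" for a
  proof -
    define u where "u = Transposition.transpose a (inv q j)"
    have u: "u permutes S" "u \<circ> u = id" "u a = inv q j" "u (inv q j) = a"
      using a b by (simp_all add: u_def permutes_swap_id)
    have uu: "u \<circ> (u \<circ> p) = p" for p :: "'a \<Rightarrow> 'a"
      using u(2) by (metis comp_assoc id_comp)
    have "bij_betw (\<lambda>p. u \<circ> p) (F a) (F (inv q j))"
    proof (rule bij_betw_byWitness[where f' = "\<lambda>p. u \<circ> p"])
      show "(\<circ>) u ` F a \<subseteq> F (inv q j)" "(\<circ>) u ` F (inv q j) \<subseteq> F a"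
        using u by (auto simp: F_def intro: permutes_compose)
    qed (simp_all add: uu)
    then show ?thesis by (rule bij_betw_same_card)
  qed
  have "P = (\<Union>x\<in>S. F x)"
    using i by (auto simp: F_def P_def permutes_in_image)
  then have "card P = card (\<Union>x\<in>S. F x)" by simp
  also have "\<dots> = (\<Sum>x\<in>S. card (F x))"
    using S by (intro card_UN_disjoint) (auto simp: F_def finite_permutations)
  also have "\<dots> = card S * card (F (inv q j))" by (simp add: card_F)
  finally have *: "card P = card S * card (F (inv q j))" .
  have "P \<inter> {p. q (p i) = j} = F (inv q j)"
    by (auto simp: P_def F_def iq)
  then have "emeasure (measure_pmf (pmf_of_set P)) {p. q (p i) = j} = ennreal (real (card (F (inv q j))) / real (card P))"
    using P by (simp add: emeasure_pmf_of_set ennreal_of_nat_eq_real_of_nat divide_ennreal card_gt_0_iff)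
  also have "real (card (F (inv q j))) / real (card P) = 1 / real (card S)"
    using P * by (auto simp: field_simps)
  finally show ?thesis by (simp add: P_def)
qed

section \<open>Appending one request to a run\<close>

lemma alg_cost_snoc: "alg_cost d k A (h @ [r]) = alg_cost d k A h + step_cost d k A h r"
  by (simp add: alg_cost_def nth_append)

text \<open>\<open>swap_run\<close> recurses on the first request, whereas histories grow at the
  end; this form supports induction over histories.\<close>

lemma swap_run_snoc:
  "swap_run d k A g (h @ [r]) s = bind_pmf (swap_run d k A g h s) (swap_step d k A g r)"
proof (induction h arbitrary: s)
  case Nil
  have "swap_run d k A g [] = return_pmf" by (simp add: fun_eq_iff)
  then show ?case by (simp add: bind_return_pmf bind_return_pmf')
next
  case (Cons a h)
  then have "swap_run d k A g (h @ [r]) = (\<lambda>s. bind_pmf (swap_run d k A g h s) (swap_step d k A g r))"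
    by (simp add: fun_eq_iff)
  then show ?case by (simp add: bind_assoc_pmf)
qed

lemma phased_swapping_snoc:
  "phased_swapping d k A g (h @ [r]) = bind_pmf (phased_swapping d k A g h) (swap_step d k A g r)"
  unfolding phased_swapping_def bind_assoc_pmf by (simp add: swap_run_snoc cong: bind_pmf_cong)

lemma set_pmf_random_permutation:
  "set_pmf (pmf_of_set {p. p permutes {1..k::nat}}) = {p. p permutes {1..k}}"
  using permutes_id[of "{1..k}"] by (intro set_pmf_of_set) (blast intro: finite_permutations)+

lemma set_reposition:
  "set_pmf (reposition d k s) = (\<lambda>p. s\<lparr>role := (\<lambda>i. role s (p i)), pos := (\<lambda>i. pos s (p i)),
     srv_cost := (\<lambda>i. srv_cost s i + d (pos s i) (pos s (p i)))\<rparr>) ` {p. p permutes {1..k}}"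
  unfolding reposition_def set_map_pmf set_pmf_random_permutation ..

section \<open>The deterministic phases\<close>

locale bounded_servers =
  fixes M :: "'a set" and d :: "'a \<Rightarrow> 'a \<Rightarrow> real" and k :: nat and A :: "'a online_alg" and g D :: real
  assumes d_nonneg: "0 \<le> d x y"
    and d_le: "\<lbrakk>x \<in> M; y \<in> M\<rbrakk> \<Longrightarrow> d x y \<le> D"
    and k_pos: "1 \<le> k"
    and A_in: "\<lbrakk>set h \<subseteq> M; j \<in> {1..k}\<rbrakk> \<Longrightarrow> A h j \<in> M"
    and g_pos: "0 < g"
begin

definition move :: "'a list \<Rightarrow> 'a \<Rightarrow> nat \<Rightarrow> real" where
  "move h r j = d (A h j) (A (h @ [r]) j)"

text \<open>
  The phases do not depend on the random choices. They are determined by the request history;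
  the function records what each server of \<open>A\<close> has paid since the current phase began.
\<close>

fun tick :: "'a \<Rightarrow> 'a list \<times> nat \<times> (nat \<Rightarrow> real) \<Rightarrow> 'a list \<times> nat \<times> (nat \<Rightarrow> real)" where
  "tick r (h, l, x) =
     (if phase_budget g l \<le> (\<Sum>j = 1..k. x j + move h r j)
      then (h @ [r], Suc l, \<lambda>_. 0) else (h @ [r], l, \<lambda>j. x j + move h r j))"

definition clock :: "'a list \<Rightarrow> 'a list \<times> nat \<times> (nat \<Rightarrow> real)" where
  "clock h = fold tick h ([], 1, \<lambda>_. 0)"

definition phase_of :: "'a list \<Rightarrow> nat" where
  "phase_of h = fst (snd (clock h))"

definition load :: "'a list \<Rightarrow> nat \<Rightarrow> real" where
  "load h = snd (snd (clock h))"

definition phase_ends :: "'a list \<Rightarrow> 'a \<Rightarrow> bool" where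
  "phase_ends h r \<longleftrightarrow> phase_budget g (phase_of h) \<le> (\<Sum>j = 1..k. load h j + move h r j)"

lemma clock_eq: "clock h = (h, phase_of h, load h)"
proof -
  have "fst (clock h) = h"
    unfolding clock_def
  proof (induction h rule: rev_induct)
    case (snoc r h)
    then show ?case by (cases "fold tick h ([], 1, \<lambda>_. 0)") (simp split: if_splits)
  qed simp
  then show ?thesis by (simp add: phase_of_def load_def prod_eq_iff)
qed

lemma clock_snoc: "clock (h @ [r]) = tick r (h, phase_of h, load h)"
  unfolding clock_eq[symmetric] by (simp add: clock_def)

lemma phase_of_simps [simp]:
  "phase_of [] = 1"
  "phase_of (h @ [r]) = (if phase_ends h r then Suc (phase_of h) else phase_of h)"
proof -
  show "phase_of [] = 1" by (simp add: phase_of_def clock_def)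
  show "phase_of (h @ [r]) = (if phase_ends h r then Suc (phase_of h) else phase_of h)"
    by (subst phase_of_def) (simp add: clock_snoc phase_ends_def)
qed

lemma load_simps [simp]:
  "load [] = (\<lambda>_. 0)"
  "load (h @ [r]) = (if phase_ends h r then (\<lambda>_. 0) else (\<lambda>j. load h j + move h r j))"
proof -
  show "load [] = (\<lambda>_. 0)" by (simp add: load_def clock_def)
  show "load (h @ [r]) = (if phase_ends h r then (\<lambda>_. 0) else (\<lambda>j. load h j + move h r j))"
    by (subst load_def) (simp add: clock_snoc phase_ends_def)
qed

lemma step_cost_eq: "step_cost d k A h r = (\<Sum>j = 1..k. move h r j)"
  by (simp add: step_cost_def move_def)

lemma phase_of_pos: "0 < phase_of h"
  by (induction h rule: rev_induct) auto

lemma load_nonneg: "0 \<le> load h j"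
  by (induction h rule: rev_induct) (auto simp: move_def d_nonneg)

text \<open>The request that reaches the budget resets the load, so it is never counted here. This
  supplies the hypothesis of \<open>mean_exp_le\<close>.\<close>

lemma load_le_budget: "(\<Sum>j = 1..k. load h j) \<le> phase_budget g (phase_of h)"
  by (induction h rule: rev_induct) (auto simp: phase_budget_def phase_ends_def)

text \<open>A completed phase pays at least its budget, which dominates the increment of the power
  by \<open>powr_Suc_diff_le\<close>. The load of the open phase is carried along for the induction.
  Phases are numbered from \<open>1\<close>, hence the \<open>- 1\<close>.\<close>

lemma completed_phases_le:
  "real (phase_of h - 1) powr (g + 1) / (g + 1) + (\<Sum>j = 1..k. load h j) \<le> alg_cost d k A h"
proof (induction h rule: rev_induct)
  case Nil
  then show ?case using g_pos by (simp add: alg_cost_def)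
next
  case (snoc r h)
  show ?case
  proof (cases "phase_ends h r")
    case True
    obtain n where n: "phase_of h = Suc n" using phase_of_pos gr0_conv_Suc by blast
    have "real (Suc n) powr (g + 1) / (g + 1) - real n powr (g + 1) / (g + 1) \<le> real (Suc n) powr g"
      using powr_Suc_diff_le[OF g_pos, of n] g_pos
      by (simp add: divide_le_eq mult.commute flip: diff_divide_distrib)
    moreover have "real (Suc n) powr g \<le> (\<Sum>j = 1..k. load h j) + step_cost d k A h r"
      using True n by (simp add: phase_ends_def phase_budget_def sum.distrib step_cost_eq)
    ultimately show ?thesis
      using snoc True n by (simp add: alg_cost_snoc)
  next
    case False
    then show ?thesis
      using snoc by (simp add: alg_cost_snoc sum.distrib step_cost_eq)
  qed
qed

section \<open>Consistent states and the total cost\<close>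

text \<open>The invariant of every reachable state: apart from roles and paid costs, the state of
  the \<open>k\<close> servers is determined by the history.\<close>

definition consistent :: "'a list \<Rightarrow> 'a swap_state \<Rightarrow> bool" where
  "consistent h s \<longleftrightarrow> hist s = h \<and> phase s = phase_of h \<and> counter s = (\<Sum>j = 1..k. load h j) \<and>
     role s permutes {1..k} \<and> (\<forall>i \<in> {1..k}. pos s i = A h (role s i))"

lemma
  assumes "consistent h s"
  shows consistent_role: "role s permutes {1..k}"
    and consistent_role_in: "i \<in> {1..k} \<Longrightarrow> role s i \<in> {1..k}"
    and consistent_pos: "i \<in> {1..k} \<Longrightarrow> pos s i = A h (role s i)"
    and consistent_ends:
      "phase_budget g (phase (serve d k A r s)) \<le> counter (serve d k A r s) \<longleftrightarrow> phase_ends h r"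
    and srv_cost_serve: "i \<in> {1..k} \<Longrightarrow> srv_cost (serve d k A r s) i = srv_cost s i + move h r (role s i)"
    and role_serve: "role (serve d k A r s) = role s"
proof -
  show role: "role s permutes {1..k}" using assms by (simp add: consistent_def)
  then show "i \<in> {1..k} \<Longrightarrow> role s i \<in> {1..k}" by (rule permutes_in_image[THEN iffD2])
qed (use assms in \<open>auto simp: consistent_def serve_def Let_def phase_ends_def sum.distrib
       step_cost_eq move_def\<close>)

lemma swap_step_consistent:
  assumes "consistent h s"
  shows "swap_step d k A g r s =
    (if phase_ends h r
     then reposition d k (serve d k A r s \<lparr>phase := phase (serve d k A r s) + 1, counter := 0\<rparr>)
     else return_pmf (serve d k A r s))"
  using consistent_ends[OF assms, of r] by (simp add: swap_step_def Let_def)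

lemma consistent_reposition:
  assumes "consistent h s" "s' \<in> set_pmf (reposition d k s)"
  shows "consistent h s'"
proof -
  obtain p where p: "p permutes {1..k}"
      and s': "role s' = role s \<circ> p" "pos s' = (\<lambda>i. pos s (p i))"
        "hist s' = hist s" "phase s' = phase s" "counter s' = counter s"
    using assms(2) by (auto simp: set_reposition comp_def)
  have "p i \<in> {1..k}" if "i \<in> {1..k}" for i
    using p that by (rule permutes_in_image[THEN iffD2])
  then show ?thesis
    using assms(1) p unfolding consistent_def s' by (simp add: permutes_compose del: One_nat_def atLeastAtMost_iff)
qed

lemma sum_srv_cost_reposition:
  assumes "consistent h s" "set h \<subseteq> M" "s' \<in> set_pmf (reposition d k s)"
  shows "(\<Sum>i = 1..k. srv_cost s' i) \<le> (\<Sum>i = 1..k. srv_cost s i) + real k * D"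
proof -
  obtain p where p: "p permutes {1..k}"
      and s': "srv_cost s' = (\<lambda>i. srv_cost s i + d (pos s i) (pos s (p i)))"
    using assms(3) by (auto simp: set_reposition)
  have "(\<Sum>i = 1..k. d (pos s i) (pos s (p i))) \<le> (\<Sum>i = 1..k. D)"
  proof (intro sum_mono d_le)
    fix i assume i: "i \<in> {1..k}"
    then have "p i \<in> {1..k}" using p by (rule permutes_in_image[THEN iffD2, rotated])
    then show "pos s i \<in> M" "pos s (p i) \<in> M"
      using i assms by (simp_all only: consistent_pos[OF assms(1)] A_in consistent_role_in)
  qed
  then show ?thesis by (simp add: s' sum.distrib)
qed

lemma consistent_init: "consistent [] (swap_init A)"
  by (simp add: consistent_def swap_init_def permutes_id)

lemma consistent_serve:
  assumes "consistent h s"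
  shows "consistent (h @ [r])
    (if phase_ends h r then serve d k A r s \<lparr>phase := phase (serve d k A r s) + 1, counter := 0\<rparr>
     else serve d k A r s)"
  using assms by (auto simp: consistent_def serve_def Let_def sum.distrib step_cost_eq)

text \<open>Roles form a permutation, so serving costs sum to the cost of \<open>A\<close> in every
  outcome. Each repositioning adds at most \<open>k * D\<close>; the initial one is counted because
  \<open>phase_of [] = 1\<close>.\<close>

lemma run_support:
  assumes "set h \<subseteq> M" "s \<in> set_pmf (phased_swapping d k A g h)"
  shows "consistent h s \<and>
    (\<Sum>i = 1..k. srv_cost s i) \<le> alg_cost d k A h + real (phase_of h) * (real k * D)"
  using assms
proof (induction h arbitrary: s rule: rev_induct)
  case Nil
  then have s: "s \<in> set_pmf (reposition d k (swap_init A))"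
    by (simp add: phased_swapping_def bind_return_pmf')
  from sum_srv_cost_reposition[OF consistent_init _ s] consistent_reposition[OF consistent_init s]
  show ?case by (simp add: alg_cost_def swap_init_def)
next
  case (snoc r h)
  obtain t where t: "t \<in> set_pmf (phased_swapping d k A g h)" and st: "s \<in> set_pmf (swap_step d k A g r t)"
    using snoc.prems by (auto simp: phased_swapping_snoc)
  have hM: "set h \<subseteq> M" "set (h @ [r]) \<subseteq> M" using snoc.prems by auto
  have con: "consistent h t"
    and cost: "(\<Sum>i = 1..k. srv_cost t i) \<le> alg_cost d k A h + real (phase_of h) * (real k * D)"
    using snoc.IH[OF hM(1) t] by auto
  have "(\<Sum>i = 1..k. srv_cost (serve d k A r t) i) = (\<Sum>i = 1..k. srv_cost t i) + (\<Sum>i = 1..k. move h r (role t i))"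
    by (simp add: srv_cost_serve[OF con] sum.distrib)
  also have "(\<Sum>i = 1..k. move h r (role t i)) = step_cost d k A h r"
    unfolding step_cost_eq by (rule sum.permute[OF consistent_role[OF con], symmetric, unfolded comp_def])
  finally have serve: "(\<Sum>i = 1..k. srv_cost (serve d k A r t) i)
      \<le> alg_cost d k A (h @ [r]) + real (phase_of h) * (real k * D)"
    using cost by (simp add: alg_cost_snoc)
  show ?case
  proof (cases "phase_ends h r")
    case True
    let ?u = "serve d k A r t \<lparr>phase := phase (serve d k A r t) + 1, counter := 0\<rparr>"
    have u: "consistent (h @ [r]) ?u" and s: "s \<in> set_pmf (reposition d k ?u)"
      using consistent_serve[OF con, of r] st True by (simp_all add: swap_step_consistent[OF con])
    from consistent_reposition[OF u s] sum_srv_cost_reposition[OF u hM(2) s] serve True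
    show ?thesis by (simp add: algebra_simps)
  next
    case False
    then have "s = serve d k A r t" using st by (simp add: swap_step_consistent[OF con])
    with serve consistent_serve[OF con, of r] False show ?thesis by simp
  qed
qed

lemma run_consistent:
  assumes "set h \<subseteq> M" "s \<in> set_pmf (phased_swapping d k A g h)"
  shows "consistent h s"
  using run_support[OF assms] by blast

section \<open>Exponential moments separated by role\<close>

text \<open>The moment is restricted to the event that \<open>i\<close> plays \<open>j\<close>; its
  values in \<open>ennreal\<close> avoid integrability conditions.\<close>

definition role_mgf :: "real \<Rightarrow> 'a list \<Rightarrow> nat \<Rightarrow> nat \<Rightarrow> ennreal" where
  "role_mgf lam h i j = (\<integral>\<^sup>+s. ennreal (exp (lam * srv_cost s i)) * indicator {s. role s i = j} s
     \<partial>phased_swapping d k A g h)"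

lemma D_nonneg: "0 \<le> D"
  using d_le[of "A [] 1" "A [] 1"] d_nonneg[of "A [] 1" "A [] 1"] A_in[of "[]" 1] k_pos by auto

text \<open>The distance moved is correlated with the new role. Bounding it by \<open>D\<close>
  first leaves only the indicator random, and a fresh uniform permutation gives it mass
  \<open>1 / k\<close>.\<close>

lemma reposition_mgf_le:
  assumes s: "consistent h s" and hM: "set h \<subseteq> M" and i: "i \<in> {1..k}" and j: "j \<in> {1..k}" and lam: "0 \<le> lam"
  shows "(\<integral>\<^sup>+s'. ennreal (exp (lam * srv_cost s' i)) * indicator {s'. role s' i = j} s' \<partial>reposition d k s)
         \<le> ennreal (exp (lam * D) / real k * exp (lam * srv_cost s i))"
proof -
  let ?P = "pmf_of_set {p. p permutes {1..k}}"
  let ?c = "exp (lam * D) * exp (lam * srv_cost s i)"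
  have "(\<integral>\<^sup>+s'. ennreal (exp (lam * srv_cost s' i)) * indicator {s'. role s' i = j} s' \<partial>reposition d k s)
      = (\<integral>\<^sup>+p. ennreal (exp (lam * (srv_cost s i + d (pos s i) (pos s (p i)))))
                * indicator {p. role s (p i) = j} p \<partial>?P)"
    by (simp add: reposition_def indicator_def)
  also have "\<dots> \<le> (\<integral>\<^sup>+p. ennreal ?c * indicator {p. role s (p i) = j} p \<partial>?P)"
  proof (intro nn_integral_mono_AE, unfold AE_measure_pmf_iff, intro ballI mult_right_mono ennreal_leI)
    fix p assume "p \<in> set_pmf ?P"
    then have "p permutes {1..k}" unfolding set_pmf_random_permutation by simp
    then have "p i \<in> {1..k}" using i by (rule permutes_in_image[THEN iffD2])
    then have "d (pos s i) (pos s (p i)) \<le> D"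
      using i by (simp only: consistent_pos[OF s] consistent_role_in[OF s] A_in[OF hM] d_le)
    then have "lam * (srv_cost s i + d (pos s i) (pos s (p i))) \<le> lam * (srv_cost s i + D)"
      using lam by (intro mult_left_mono) auto
    then show "exp (lam * (srv_cost s i + d (pos s i) (pos s (p i)))) \<le> ?c"
      by (simp add: algebra_simps flip: exp_add)
  qed simp
  also have "\<dots> = ennreal ?c * ennreal (1 / real k)"
    using random_permutation_image[OF _ i consistent_role[OF s] j]
    by (simp add: nn_integral_cmult_indicator)
  finally show ?thesis by (simp flip: ennreal_mult)
qed

lemma mgf_eq_sum_role_mgf:
  assumes "set h \<subseteq> M" "i \<in> {1..k}"
  shows "(\<integral>\<^sup>+s. ennreal (exp (lam * srv_cost s i)) \<partial>phased_swapping d k A g h) = (\<Sum>j = 1..k. role_mgf lam h i j)"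
proof -
  have "(\<Sum>j = 1..k. role_mgf lam h i j) =
     (\<integral>\<^sup>+s. (\<Sum>j = 1..k. ennreal (exp (lam * srv_cost s i)) * indicator {s. role s i = j} s)
        \<partial>phased_swapping d k A g h)"
    unfolding role_mgf_def by (subst nn_integral_sum) auto
  also have "\<dots> = (\<integral>\<^sup>+s. ennreal (exp (lam * srv_cost s i)) \<partial>phased_swapping d k A g h)"
  proof (intro nn_integral_cong_AE, unfold AE_measure_pmf_iff, intro ballI)
    fix s assume "s \<in> set_pmf (phased_swapping d k A g h)"
    then have "role s i \<in> {1..k}"
      using run_consistent[OF assms(1)] consistent_role_in assms(2) by blast
    then show "(\<Sum>j = 1..k. ennreal (exp (lam * srv_cost s i)) * indicator {s. role s i = j} s)
        = ennreal (exp (lam * srv_cost s i))"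
      by (simp add: indicator_def if_distrib cong: if_cong flip: sum_distrib_left)
  qed
  finally show ?thesis ..
qed

text \<open>
  Contribution of the completed phases. The factor \<open>2 * D\<close> per phase pays for one repositioning
  and for the request that exceeds the budget, so that the load fed to \<open>mean_exp_le\<close> is
  at most the budget.
\<close>

definition past_bound :: "real \<Rightarrow> real \<Rightarrow> 'a list \<Rightarrow> real" where
  "past_bound lam B h = exp (2 * lam * D * real (phase_of h) +
     (exp (lam * B) - 1) * (alg_cost d k A h - (\<Sum>j = 1..k. load h j)) / (real k * B))"

text \<open>Summing over the roles produces the mean in \<open>mean_exp_le\<close>, which restores
  the load subtracted in \<open>past_bound\<close>. The bounds per role are a premise so that the
  induction below can apply this at each phase end.\<close>

lemma mgf_le_of_role_mgf_le:
  assumes hM: "set h \<subseteq> M" and i: "i \<in> {1..k}" and lam: "0 \<le> lam"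
    and B: "0 < B" "phase_budget g (phase_of h) \<le> B"
    and le: "\<And>j. j \<in> {1..k} \<Longrightarrow> role_mgf lam h i j \<le> ennreal (exp (lam * load h j) / real k * past_bound lam B h)"
  shows "(\<integral>\<^sup>+s. ennreal (exp (lam * srv_cost s i)) \<partial>phased_swapping d k A g h)
    \<le> ennreal (exp (2 * lam * D * real (phase_of h) + (exp (lam * B) - 1) * alg_cost d k A h / (real k * B)))"
proof -
  have "(\<integral>\<^sup>+s. ennreal (exp (lam * srv_cost s i)) \<partial>phased_swapping d k A g h)
      \<le> (\<Sum>j = 1..k. ennreal (exp (lam * load h j) / real k * past_bound lam B h))"
    unfolding mgf_eq_sum_role_mgf[OF hM i] by (intro sum_mono le)
  also have "\<dots> = ennreal ((\<Sum>j = 1..k. exp (lam * load h j)) / real k * past_bound lam B h)"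
    by (simp add: past_bound_def sum_ennreal sum_divide_distrib sum_distrib_right)
  also have "\<dots> \<le> ennreal (exp ((exp (lam * B) - 1) * (\<Sum>j = 1..k. load h j) / (real k * B)) * past_bound lam B h)"
    using load_le_budget[of h] B lam k_pos
    by (intro ennreal_leI mult_right_mono mean_exp_le load_nonneg) (auto simp: past_bound_def)
  also have "\<dots> = ennreal (exp (2 * lam * D * real (phase_of h) + (exp (lam * B) - 1) * alg_cost d k A h / (real k * B)))"
    by (simp add: past_bound_def algebra_simps add_divide_distrib diff_divide_distrib flip: exp_add)
  finally show ?thesis .
qed

text \<open>
  Within a phase the role of server \<open>i\<close> is uniform and independent of the cost it paid before that
  phase. Keeping the exponential moment separately for every role makes this an invariant of
  the requests.
\<close>

lemma role_mgf_le:
  assumes "set h \<subseteq> M" and i: "i \<in> {1..k}" and "j \<in> {1..k}" and lam: "0 \<le> lam"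
    and "0 < B" "phase_budget g (phase_of h) \<le> B"
  shows "role_mgf lam h i j \<le> ennreal (exp (lam * load h j) / real k * past_bound lam B h)"
  using assms(1,3,5,6)
proof (induction h arbitrary: j rule: rev_induct)
  case Nil
  have "role_mgf lam [] i j \<le> ennreal (exp (lam * D) / real k * exp (lam * srv_cost (swap_init A) i))"
    using reposition_mgf_le[OF consistent_init _ i \<open>j \<in> {1..k}\<close> lam]
    by (simp add: role_mgf_def phased_swapping_def bind_return_pmf')
  \<comment> \<open>As \<open>phase_of [] = 1\<close>, \<open>past_bound\<close> already contains
    \<open>exp (2 * lam * D)\<close>, which covers the initial repositioning.\<close>
  also have "\<dots> \<le> ennreal (exp (lam * load [] j) / real k * past_bound lam B [])"
    using D_nonneg lam
    by (intro ennreal_leI) (simp add: past_bound_def alg_cost_def swap_init_def divide_right_mono mult_left_mono)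
  finally show ?case .
next
  case (snoc r h)
  have hM: "set h \<subseteq> M" "set (h @ [r]) \<subseteq> M" using snoc.prems by auto
  \<comment> \<open>Budgets grow with the phase number, so the same \<open>B\<close> serves all
    shorter histories.\<close>
  have "phase_budget g (phase_of h) \<le> phase_budget g (phase_of (h @ [r]))"
    using g_pos by (auto simp: phase_budget_def intro: powr_mono2)
  then have B: "0 < B" "phase_budget g (phase_of h) \<le> B" using snoc.prems by auto
  let ?Q = "phased_swapping d k A g h"
  have eq: "role_mgf lam (h @ [r]) i j = (\<integral>\<^sup>+s. (\<integral>\<^sup>+s'. ennreal (exp (lam * srv_cost s' i))
      * indicator {s'. role s' i = j} s' \<partial>swap_step d k A g r s) \<partial>?Q)"
    by (simp add: role_mgf_def phased_swapping_snoc)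
  have move_le: "move h r j' \<le> D" if "j' \<in> {1..k}" for j'
    unfolding move_def using that hM by (intro d_le A_in)
  show ?case
  proof (cases "phase_ends h r")
    case True
    have "role_mgf lam (h @ [r]) i j \<le> (\<integral>\<^sup>+s. ennreal (exp (2 * lam * D) / real k) * ennreal (exp (lam * srv_cost s i)) \<partial>?Q)"
      unfolding eq
    proof (intro nn_integral_mono_AE, unfold AE_measure_pmf_iff, intro ballI)
      fix s assume "s \<in> set_pmf ?Q"
      then have s: "consistent h s" by (rule run_consistent[OF hM(1)])
      let ?u = "serve d k A r s \<lparr>phase := phase (serve d k A r s) + 1, counter := 0\<rparr>"
      have u: "consistent (h @ [r]) ?u" using consistent_serve[OF s, of r] True by simp
      have "(\<integral>\<^sup>+s'. ennreal (exp (lam * srv_cost s' i)) * indicator {s'. role s' i = j} s' \<partial>swap_step d k A g r s)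
          \<le> ennreal (exp (lam * D) / real k * exp (lam * srv_cost ?u i))"
        using reposition_mgf_le[OF u hM(2) i \<open>j \<in> {1..k}\<close> lam] True
        by (simp add: swap_step_consistent[OF s])
      \<comment> \<open>One \<open>D\<close> pays for the repositioning, the other for the request
        that ends the phase.\<close>
      also have "\<dots> \<le> ennreal (exp (lam * D) / real k * exp (lam * (srv_cost s i + D)))"
        using lam move_le[OF consistent_role_in[OF s i]]
        by (intro ennreal_leI mult_left_mono) (auto simp: srv_cost_serve[OF s i] intro!: mult_left_mono)
      also have "\<dots> = ennreal (exp (2 * lam * D) / real k) * ennreal (exp (lam * srv_cost s i))"
        by (simp add: algebra_simps flip: ennreal_mult exp_add)
      finally show "(\<integral>\<^sup>+s'. ennreal (exp (lam * srv_cost s' i)) * indicator {s'. role s' i = j} s' \<partial>swap_step d k A g r s)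
          \<le> \<dots>" .
    qed
    also have "\<dots> = ennreal (exp (2 * lam * D) / real k) * (\<integral>\<^sup>+s. ennreal (exp (lam * srv_cost s i)) \<partial>?Q)"
      by (rule nn_integral_cmult) simp
    also have "\<dots> \<le> ennreal (exp (2 * lam * D) / real k) * ennreal (exp (2 * lam * D * real (phase_of h)
        + (exp (lam * B) - 1) * alg_cost d k A h / (real k * B)))"
      by (intro mult_left_mono mgf_le_of_role_mgf_le hM i lam B snoc.IH) simp_all
    also have "\<dots> = ennreal (exp (2 * lam * D * real (phase_of (h @ [r]))
        + (exp (lam * B) - 1) * alg_cost d k A h / (real k * B)) / real k)"
      using True by (simp add: algebra_simps flip: ennreal_mult exp_add)
    \<comment> \<open>The last request, already paid for by \<open>D\<close>, is charged again
      through \<open>alg_cost\<close>; this only enlarges the bound and gives it the shape of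
      \<open>past_bound\<close> with zero load.\<close>
    also have "\<dots> \<le> ennreal (exp (2 * lam * D * real (phase_of (h @ [r]))
        + (exp (lam * B) - 1) * alg_cost d k A (h @ [r]) / (real k * B)) / real k)"
    proof -
      have "0 \<le> step_cost d k A h r" by (simp add: step_cost_def sum_nonneg d_nonneg)
      then show ?thesis
        using B lam k_pos
        by (intro ennreal_leI divide_right_mono) (simp_all add: alg_cost_snoc divide_right_mono mult_left_mono)
    qed
    finally show ?thesis using True by (simp add: past_bound_def)
  next
    case False
    \<comment> \<open>Given the role \<open>j\<close>, the request adds the deterministic cost
      \<open>move h r j\<close>, so its exponential factors out exactly.\<close>
    have "role_mgf lam (h @ [r]) i j = (\<integral>\<^sup>+s. ennreal (exp (lam * move h r j)) *
        (ennreal (exp (lam * srv_cost s i)) * indicator {s. role s i = j} s) \<partial>?Q)"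
      unfolding eq
    proof (intro nn_integral_cong_AE, unfold AE_measure_pmf_iff, intro ballI)
      fix s assume "s \<in> set_pmf ?Q"
      then have s: "consistent h s" by (rule run_consistent[OF hM(1)])
      show "(\<integral>\<^sup>+s'. ennreal (exp (lam * srv_cost s' i)) * indicator {s'. role s' i = j} s' \<partial>swap_step d k A g r s)
          = ennreal (exp (lam * move h r j)) * (ennreal (exp (lam * srv_cost s i)) * indicator {s. role s i = j} s)"
        using False
        by (auto simp: swap_step_consistent[OF s] srv_cost_serve[OF s i] role_serve[OF s] indicator_def
              algebra_simps exp_add ennreal_mult)
    qed
    also have "\<dots> = ennreal (exp (lam * move h r j)) * role_mgf lam h i j"
      unfolding role_mgf_def by (rule nn_integral_cmult) simp
    also have "\<dots> \<le> ennreal (exp (lam * move h r j)) * ennreal (exp (lam * load h j) / real k * past_bound lam B h)"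
      by (intro mult_left_mono snoc.IH hM B snoc.prems) simp
    also have "\<dots> = ennreal (exp (lam * load (h @ [r]) j) / real k * past_bound lam B (h @ [r]))"
      using False by (simp add: past_bound_def alg_cost_snoc step_cost_eq sum.distrib algebra_simps exp_add flip: ennreal_mult)
    finally show ?thesis .
  qed
qed

lemma mgf_le:
  assumes "set h \<subseteq> M" "i \<in> {1..k}" "0 \<le> lam" "0 < B" "phase_budget g (phase_of h) \<le> B"
  shows "(\<integral>\<^sup>+s. ennreal (exp (lam * srv_cost s i)) \<partial>phased_swapping d k A g h)
    \<le> ennreal (exp (2 * lam * D * real (phase_of h) + (exp (lam * B) - 1) * alg_cost d k A h / (real k * B)))"
  using assms by (intro mgf_le_of_role_mgf_le role_mgf_le)

section \<open>Tail bounds\<close>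

text \<open>Markov's inequality for \<open>exp (lam * srv_cost s i)\<close>. The phase terms of the
  threshold and of \<open>mgf_le\<close> cancel.\<close>

lemma srv_cost_tail:
  fixes e e0 :: real
  assumes hM: "set h \<subseteq> M" and i: "i \<in> {1..k}" and e: "0 < e" "e \<le> e0"
  defines "B \<equiv> phase_budget g (phase_of h)" and "W \<equiv> alg_cost d k A h"
  shows "measure_pmf.prob (phased_swapping d k A g h)
           {s. (1 + e) * (W / real k) + 2 * D * real (phase_of h) < srv_cost s i}
         \<le> exp (- (e\<^sup>2 / (2 * (2 + e0)) * (W / (real k * B))))"
proof -
  \<comment> \<open>Dividing by \<open>B\<close> makes \<open>lam * B\<close> the value treated in
    \<open>exp_exponent_le\<close>.\<close>
  define lam where "lam = e / (2 + e0) / B"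
  define thr where "thr = (1 + e) * (W / real k) + 2 * D * real (phase_of h)"
  let ?Q = "phased_swapping d k A g h"
  have B: "0 < B" using phase_of_pos[of h] by (simp add: B_def phase_budget_def)
  have lam: "0 \<le> lam" "lam * B = e / (2 + e0)" using e B by (simp_all add: lam_def)
  have W: "0 \<le> W" unfolding W_def alg_cost_def step_cost_def by (intro sum_nonneg d_nonneg)
  have "emeasure ?Q {s. thr < srv_cost s i} = (\<integral>\<^sup>+s. indicator {s. thr < srv_cost s i} s \<partial>?Q)"
    by simp
  also have "\<dots> \<le> (\<integral>\<^sup>+s. ennreal (exp (- lam * thr)) * ennreal (exp (lam * srv_cost s i)) \<partial>?Q)"
  proof (intro nn_integral_mono)
    fix s
    have "1 \<le> exp (- lam * thr) * exp (lam * srv_cost s i)" if "thr < srv_cost s i"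
    proof -
      have "lam * thr \<le> lam * srv_cost s i" using that lam by (intro mult_left_mono) auto
      then show ?thesis by (simp flip: exp_add)
    qed
    then show "indicator {s. thr < srv_cost s i} s \<le> ennreal (exp (- lam * thr)) * ennreal (exp (lam * srv_cost s i))"
      by (auto simp: indicator_def simp flip: ennreal_mult)
  qed
  also have "\<dots> = ennreal (exp (- lam * thr)) * (\<integral>\<^sup>+s. ennreal (exp (lam * srv_cost s i)) \<partial>?Q)"
    by (rule nn_integral_cmult) simp
  also have "\<dots> \<le> ennreal (exp (- lam * thr)) * ennreal (exp (2 * lam * D * real (phase_of h) + (exp (lam * B) - 1) * W / (real k * B)))"
    unfolding W_def using B lam hM i by (intro mult_left_mono mgf_le) (auto simp: B_def)
  also have "\<dots> = ennreal (exp ((exp (lam * B) - 1 - lam * B * (1 + e)) * (W / (real k * B))))"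
    using B k_pos by (simp add: thr_def field_simps flip: ennreal_mult exp_add)
  also have "\<dots> \<le> ennreal (exp (- (e\<^sup>2 / (2 * (2 + e0))) * (W / (real k * B))))"
    unfolding lam(2) exp_le_cancel_iff using B W k_pos
    by (intro ennreal_leI, unfold exp_le_cancel_iff, intro mult_right_mono exp_exponent_le e) auto
  finally show ?thesis
    by (simp add: measure_pmf.emeasure_eq_measure thr_def)
qed

end

text \<open>Union bound over the servers. The free \<open>thr\<close> allows the phase number to be
  replaced by its upper bound later.\<close>

lemma (in bounded_servers) all_srv_cost_tail:
  fixes e e0 :: real
  assumes hM: "set h \<subseteq> M" and e: "0 < e" "e \<le> e0"
    and thr: "(1 + e) * (alg_cost d k A h / real k) + 2 * D * real (phase_of h) \<le> thr"
  shows "1 - real k * exp (- (e\<^sup>2 / (2 * (2 + e0)) * (alg_cost d k A h / (real k * phase_budget g (phase_of h)))))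
    \<le> measure_pmf.prob (phased_swapping d k A g h) {s. \<forall>i \<in> {1..k}. srv_cost s i \<le> thr}"
    (is "1 - real k * ?p \<le> _")
proof -
  let ?Q = "phased_swapping d k A g h"
  let ?F = "\<lambda>i. {s. thr < srv_cost s i}"
  have "measure_pmf.prob ?Q (\<Union>i\<in>{1..k}. ?F i) \<le> (\<Sum>i = 1..k. measure_pmf.prob ?Q (?F i))"
    by (intro measure_pmf.finite_measure_subadditive_finite) auto
  also have "\<dots> \<le> (\<Sum>i = 1..k. ?p)"
  proof (intro sum_mono)
    fix i assume i: "i \<in> {1..k}"
    have "measure_pmf.prob ?Q (?F i) \<le> measure_pmf.prob ?Q
        {s. (1 + e) * (alg_cost d k A h / real k) + 2 * D * real (phase_of h) < srv_cost s i}"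
      using thr by (intro measure_pmf.finite_measure_mono) auto
    also have "\<dots> \<le> ?p" by (rule srv_cost_tail[OF hM i e])
    finally show "measure_pmf.prob ?Q (?F i) \<le> ?p" .
  qed
  finally have "measure_pmf.prob ?Q (\<Union>i\<in>{1..k}. ?F i) \<le> real k * ?p" by simp
  moreover have eq: "{s. \<forall>i \<in> {1..k}. srv_cost s i \<le> thr} = UNIV - (\<Union>i\<in>{1..k}. ?F i)"
    by (auto simp: not_less)
  have "measure_pmf.prob ?Q {s. \<forall>i \<in> {1..k}. srv_cost s i \<le> thr}
      = 1 - measure_pmf.prob ?Q (\<Union>i\<in>{1..k}. ?F i)"
    unfolding eq using measure_pmf.prob_compl[of "\<Union>i\<in>{1..k}. ?F i" ?Q] by simp
  ultimately show ?thesis by linarith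
qed

section \<open>Choice of constants\<close>

text \<open>\<open>K\<close> is the constant of \<open>phase_number_le\<close>. The first upper
  bound on \<open>a\<close> serves the case \<open>g \<le> w\<close>, the second the case
  \<open>w < g\<close>.\<close>

lemma server_cost_bounds:
  fixes M :: "'a set" and d :: "'a \<Rightarrow> 'a \<Rightarrow> real" and c0 g0 e0 g e K a :: real
  assumes "Metric_space M d" and bounded: "Metric_space.mbounded M d M"
    and k: "1 \<le> k" and alg: "kserver_alg M k A" and hM: "set h \<subseteq> M"
    and g0: "0 < g0" "g0 \<le> g" and e: "0 < e" "e \<le> e0"
    and c0: "0 < c0" "c0 \<le> alg_cost d k A h"
    and K: "K = 3 + 1 / min 1 c0"
    and a: "0 < a" "a \<le> 1 / (2 * (2 + e0)) / (3 * (1 + 1 / g0))" "a \<le> 1 / (1 + e0\<^sup>2)"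
  defines "w \<equiv> alg_cost d k A h powr (1 / (g + 1))"
  shows "measure_pmf.prob (phased_swapping d k A g h)
      {s. \<forall>i \<in> {1..k}. srv_cost s i \<le> (1 + e) * (alg_cost d k A h / real k) + 2 * K * (w * space_diam M d)}
        \<ge> 1 - real k * exp (- (a * (e\<^sup>2 / (g * real k) * w)))"
    and "\<forall>s \<in> set_pmf (phased_swapping d k A g h).
      (\<Sum>i = 1..k. srv_cost s i) \<le> alg_cost d k A h + 2 * K * (w * real k * space_diam M d)"
proof -
  interpret Metric_space M d by fact
  obtain b where b: "\<forall>x\<in>M. \<forall>y\<in>M. d x y \<le> b"
    using bounded unfolding mbounded_alt by blast
  have "bdd_above {d x y | x y. x \<in> M \<and> y \<in> M}"
    by (rule bdd_aboveI[of _ b]) (use b in auto)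
  then have "d x y \<le> space_diam M d" if "x \<in> M" "y \<in> M" for x y
    using that unfolding space_diam_def by (intro cSup_upper) auto
  then interpret S: bounded_servers M d k A g "space_diam M d"
    using k alg g0 by unfold_locales (auto simp: kserver_alg_def lists_eq_set)
  have e0: "0 < e0" using e by simp
  have pos0: "0 < 1 + 1 / g0" "0 < 1 + e0\<^sup>2" using g0 by (simp_all add: add_pos_pos add_pos_nonneg)
  have K0: "0 < K" using c0 by (simp add: K add_pos_pos)
  let ?W = "alg_cost d k A h" and ?D = "space_diam M d" and ?Q = "phased_swapping d k A g h"
  have pos: "0 < g" "0 < ?W" "0 < w" using g0 c0 by (simp_all add: w_def)
  obtain n where n: "S.phase_of h = Suc n" using S.phase_of_pos gr0_conv_Suc by blast
  have nW: "real n powr (g + 1) / (g + 1) \<le> ?W"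
    using S.completed_phases_le[of h] sum_nonneg[of "{1..k}" "S.load h"] S.load_nonneg n by simp
  have l: "real (S.phase_of h) \<le> K * w"
    unfolding n K w_def using pos c0 nW by (intro phase_number_le)
  have lD: "?D * real (S.phase_of h) \<le> ?D * (K * w)"
    by (rule mult_left_mono[OF l S.D_nonneg])
  have total: "(\<Sum>i = 1..k. srv_cost s i) \<le> ?W + 2 * K * (w * real k * ?D)" if "s \<in> set_pmf ?Q" for s
  proof -
    have "real k * (?D * real (S.phase_of h)) \<le> real k * (?D * (K * w))"
      by (rule mult_left_mono[OF lD]) simp
    moreover have "0 \<le> real k * (?D * (K * w))"
      using K0 pos S.D_nonneg by simp
    moreover have "2 * K * (w * real k * ?D) = 2 * (real k * (?D * (K * w)))" by simp
    moreover have "real (S.phase_of h) * (real k * ?D) = real k * (?D * real (S.phase_of h))" by simp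
    ultimately show ?thesis using S.run_support[OF hM that] by linarith
  qed
  then show "\<forall>s \<in> set_pmf ?Q. (\<Sum>i = 1..k. srv_cost s i) \<le> ?W + 2 * K * (w * real k * ?D)"
    by blast
  let ?thr = "(1 + e) * (?W / real k) + 2 * K * (w * ?D)"
  show "1 - real k * exp (- (a * (e\<^sup>2 / (g * real k) * w)))
      \<le> measure_pmf.prob ?Q {s. \<forall>i \<in> {1..k}. srv_cost s i \<le> ?thr}"
  proof (cases "k = 1")
    case True
    have "srv_cost s 1 \<le> ?thr" if "s \<in> set_pmf ?Q" for s
    proof -
      have "0 \<le> e * ?W" using e pos by simp
      then show ?thesis using total[OF that] True by (simp add: distrib_right)
    qed
    then have "measure_pmf.prob ?Q {s. \<forall>i \<in> {1..k}. srv_cost s i \<le> ?thr} = 1"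
      unfolding True by (subst measure_pmf.prob_eq_1) (auto simp: AE_measure_pmf_iff)
    then show ?thesis by simp
  next
    case k: False
    show ?thesis
    proof (cases "g \<le> w")
      \<comment> \<open>Here \<open>a\<close> times the square of \<open>e\<close> is at most
        \<open>1\<close> and \<open>w < g\<close>, so the exponent is at most
        \<open>1 / 2 < ln 2\<close> in absolute value. With \<open>k \<ge> 2\<close> the claimed
        probability is then at most \<open>0\<close>.\<close>
      case False
      have "e\<^sup>2 \<le> e0\<^sup>2" using e by (intro power_mono) auto
      then have "e\<^sup>2 \<le> 1 + e0\<^sup>2" by simp
      then have "a * e\<^sup>2 \<le> 1 / (1 + e0\<^sup>2) * (1 + e0\<^sup>2)"
        using a by (intro mult_mono) (auto simp: add_nonneg_nonneg)
      also have "\<dots> = 1" using pos0 by simp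
      finally have ae: "a * e\<^sup>2 \<le> 1" .
      have k2: "2 \<le> real k" using k S.k_pos by simp
      have "w / (g * real k) \<le> g / (g * real k)"
        using False pos by (intro divide_right_mono) auto
      also have "\<dots> \<le> 1 / 2" using pos k2 by (simp add: field_simps)
      finally have "(a * e\<^sup>2) * (w / (g * real k)) \<le> 1 * (1 / 2)"
        using ae a pos by (intro mult_mono) auto
      also have "\<dots> \<le> ln 2" using ln2_ge_two_thirds by simp
      finally have "exp (- ln 2) \<le> exp (- (a * (e\<^sup>2 / (g * real k) * w)))"
        by simp
      then have "1 / 2 \<le> exp (- (a * (e\<^sup>2 / (g * real k) * w)))"
        by (simp add: exp_minus)
      then have "2 * (1 / 2) \<le> real k * exp (- (a * (e\<^sup>2 / (g * real k) * w)))"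
        using k2 by (intro mult_mono) auto
      then have "1 - real k * exp (- (a * (e\<^sup>2 / (g * real k) * w))) \<le> 0" by simp
      then show ?thesis using measure_nonneg order_trans by blast
    next
      case True
      define B where "B = phase_budget g (Suc n)"
      have B: "0 < B" by (simp add: B_def phase_budget_def)
      have "B * w \<le> 3 * (g + 1) * ?W"
        unfolding B_def w_def using pos nW True by (intro phase_budget_le) (auto simp: w_def)
      \<comment> \<open>From \<open>g \<ge> g0\<close> follows
        \<open>g + 1 \<le> (1 + 1 / g0) * g\<close>, which makes the constant uniform in
        \<open>g\<close>.\<close>
      moreover have "3 * (g + 1) * ?W \<le> 3 * (1 + 1 / g0) * g * ?W"
        using g0 pos by (intro mult_right_mono) (auto simp: field_simps)
      ultimately have Bw: "B * w \<le> 3 * (1 + 1 / g0) * g * ?W" by linarith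
      have "a * w / g \<le> 1 / (2 * (2 + e0)) / (3 * (1 + 1 / g0)) * w / g"
        using a pos by (intro divide_right_mono mult_right_mono) auto
      also have "\<dots> = 1 / (2 * (2 + e0)) * (B * w / (3 * (1 + 1 / g0) * g * B))"
        using B by simp
      also have "\<dots> \<le> 1 / (2 * (2 + e0)) * (3 * (1 + 1 / g0) * g * ?W / (3 * (1 + 1 / g0) * g * B))"
        using Bw B pos e0 pos0 by (intro mult_left_mono divide_right_mono) auto
      also have "\<dots> = 1 / (2 * (2 + e0)) * (?W / B)"
        using pos pos0 by simp
      finally have "e\<^sup>2 / real k * (a * w / g) \<le> e\<^sup>2 / real k * (1 / (2 * (2 + e0)) * (?W / B))"
        by (intro mult_left_mono) auto
      then have "exp (- (e\<^sup>2 / (2 * (2 + e0)) * (?W / (real k * B)))) \<le> exp (- (a * (e\<^sup>2 / (g * real k) * w)))"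
        by (simp add: mult_ac)
      then have "1 - real k * exp (- (a * (e\<^sup>2 / (g * real k) * w)))
          \<le> 1 - real k * exp (- (e\<^sup>2 / (2 * (2 + e0)) * (?W / (real k * B))))"
        by (simp add: mult_left_mono)
      also have "\<dots> \<le> measure_pmf.prob ?Q {s. \<forall>i \<in> {1..k}. srv_cost s i \<le> ?thr}"
        unfolding B_def n[symmetric] using lD by (intro S.all_srv_cost_tail hM e) (simp add: algebra_simps)
      finally show ?thesis .
    qed
  qed
qed

text \<open>\<open>C\<close> depends on \<open>c\<^sub>0\<close> alone, and \<open>a\<close> on the
  bounds for the parameters. The lower bound on the cost reflects that the first repositioning may
  cost a multiple of the diameter however little \<open>A\<close> pays.\<close>

theorem theorem9:
  shows "\<forall>c\<^sub>0 > 0. \<exists>C > 0. \<forall>\<gamma>\<^sub>0 > 0. \<forall>\<epsilon>\<^sub>0 > 0. \<exists>a > 0.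
    \<forall>(M :: 'a set) (d :: 'a \<Rightarrow> 'a \<Rightarrow> real) (k :: nat) (A :: 'a online_alg) (\<sigma> :: 'a list)
      (\<gamma> :: real) (\<epsilon> :: real).
      Metric_space M d \<longrightarrow> Metric_space.mbounded M d M \<longrightarrow>
      k \<ge> 1 \<longrightarrow> kserver_alg M k A \<longrightarrow> set \<sigma> \<subseteq> M \<longrightarrow>
      \<gamma> \<ge> \<gamma>\<^sub>0 \<longrightarrow> 0 < \<epsilon> \<longrightarrow> \<epsilon> \<le> \<epsilon>\<^sub>0 \<longrightarrow> alg_cost d k A \<sigma> \<ge> c\<^sub>0 \<longrightarrow>
      measure_pmf.prob (phased_swapping d k A \<gamma> \<sigma>)
          {s. \<forall>i \<in> {1..k}. srv_cost s i \<le>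
                (1 + \<epsilon>) * (alg_cost d k A \<sigma> / real k)
                + C * (alg_cost d k A \<sigma> powr (1 / (\<gamma> + 1)) * space_diam M d)}
        \<ge> 1 - real k * exp (- (a * (\<epsilon>\<^sup>2 / (\<gamma> * real k) * alg_cost d k A \<sigma> powr (1 / (\<gamma> + 1)))))
      \<and> (\<forall>s \<in> set_pmf (phased_swapping d k A \<gamma> \<sigma>).
            (\<Sum>i = 1..k. srv_cost s i) \<le>
              alg_cost d k A \<sigma>
              + C * (alg_cost d k A \<sigma> powr (1 / (\<gamma> + 1)) * real k * space_diam M d))"
  apply (intro allI impI)
  subgoal for c0
    apply (rule exI[of _ "2 * (3 + 1 / min 1 c0)"])
    apply (intro conjI allI impI)
     apply (simp add: add_pos_pos)
    subgoal for g0 e0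
      apply (rule exI[of _ "min (1 / (2 * (2 + e0)) / (3 * (1 + 1 / g0))) (1 / (1 + e0\<^sup>2))"])
      apply (intro conjI allI impI)
        apply (simp add: add_pos_pos add_pos_nonneg)
       apply (rule server_cost_bounds(1)[where ?c0.0 = c0 and ?g0.0 = g0 and ?e0.0 = e0];
          simp add: add_pos_pos add_pos_nonneg)
      apply (rule server_cost_bounds(2)[where ?c0.0 = c0 and ?g0.0 = g0 and ?e0.0 = e0 and
            a = "min (1 / (2 * (2 + e0)) / (3 * (1 + 1 / g0))) (1 / (1 + e0\<^sup>2))"];
          simp add: add_pos_pos add_pos_nonneg)
      done
    done
  done

end
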